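(* For measurable spaces $X$ and $Y$, let $$\tau''_{X,Y}: X \otimes \mathcal{G}(Y) \to \mathcal{G}(X \times Y), \qquad (x,Q) \mapsto Q\Gamma_x^{-1},$$ where $\Gamma_x : Y \to X \times Y$ is the constant graph map $y \mapsto (x,y)$ and $Q\Gamma_x^{-1}$ is the push-forward measure $\zeta \mapsto Q(\Gamma_x^{-1}(\zeta))$. Then the maps $\tau''_{X,Y}$ are the components of a natural transformation from the functor $(X,Y)\mapsto X \otimes \mathcal{G}(Y)$ to the functor $(X,Y) \mapsto \mathcal{G}(X \times Y)$, both regarded as functors $\mathbf{Meas}\times\mathbf{Meas} \to \mathbf{Meas}$. That is, each $\tau''_{X,Y}$ is measurable, and $\tau''$ is natural in both $X$ and $Y$.
   Context: $\mathbf{Meas}$ is the category of measurable spaces and measurable maps; $\Sigma_X$ denotes the $\sigma$-algebra of a measurable space $X$. $X \times Y$ carries the product $\sigma$-algebra. $\mathcal{G}$ is the Giry functor: $\mathcal{G}(X)$ is the set of probability measures on $X$ with the $\sigma$-algebra generated by the evaluation maps $ev_A : \mathcal{G}(X) \to [0,1]$, $P \mapsto P(A)$, for $A \in \Sigma_X$; for a measurable map $f: X \to X'$, $\mathcal{G}(f): \mathcal{G}(X) \to \mathcal{G}(X')$ is the push-forward $P \mapsto Pf^{-1}$. The tensor product $X \otimes Y$ is the set $X \times Y$ with the largest $\sigma$-algebra for which all the constant graph maps $\Gamma_x: Y \to X\times Y$, $y \mapsto (x,y)$ (for $x \in X$) and $\Gamma_y : X \to X\times Y$, $x \mapsto (x,y)$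 (for $y \in Y$) are measurable. For measurable maps $f: X\to X'$ and $g: Y \to Y'$, $f \otimes g: X \otimes Y \to X' \otimes Y'$ is the map $(x,y) \mapsto (f(x),g(y))$. The first functor sends $(f,g)$ to $f \otimes \mathcal{G}(g)$ and the second sends $(f,g)$ to $\mathcal{G}(f \times g)$. *)

theory Defs
  imports "HOL-Probability.Giry_Monad"
begin

text \<open>
  A measurable space is represented by a value of type \<^typ>\<open>'a measure\<close> of which only \<open>space\<close>
  and \<open>sets\<close> are used; an arrow from \<open>X\<close> to \<open>Y\<close> is an element of \<open>X \<rightarrow>\<^sub>M Y\<close>, and two arrows are
  equal if they agree on \<open>space X\<close>.  The object part of the Giry functor is \<^const>\<open>prob_algebra\<close>,
  and the product functor is \<open>X \<Otimes>\<^sub>M Y\<close> on objects and \<^const>\<open>map_prod\<close> on arrows.  The constant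
  graph maps are \<open>Pair x\<close> and \<open>\<lambda>x. (x, y)\<close>.
\<close>

definition tensor_sets :: "'a measure \<Rightarrow> 'b measure \<Rightarrow> ('a \<times> 'b) set set" where
  "tensor_sets X Y = (GREATEST S. sigma_algebra (space X \<times> space Y) S \<and>
     (\<forall>x\<in>space X. Pair x \<in> Y \<rightarrow>\<^sub>M sigma (space X \<times> space Y) S) \<and>
     (\<forall>y\<in>space Y. (\<lambda>x. (x, y)) \<in> X \<rightarrow>\<^sub>M sigma (space X \<times> space Y) S))"

definition tensor_space :: "'a measure \<Rightarrow> 'b measure \<Rightarrow> ('a \<times> 'b) measure" where
  "tensor_space X Y = sigma (space X \<times> space Y) (tensor_sets X Y)"

definition giry_map :: "'b measure \<Rightarrow> ('a \<Rightarrow> 'b) \<Rightarrow> 'a measure \<Rightarrow> 'b measure" where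
  "giry_map Y g = (\<lambda>Q. distr Q Y g)"

definition tau :: "'a measure \<Rightarrow> 'b measure \<Rightarrow> 'a \<times> 'b measure \<Rightarrow> ('a \<times> 'b) measure" where
  "tau X Y = (\<lambda>(x, Q). distr Q (X \<Otimes>\<^sub>M Y) (Pair x))"


text \<open>The greatest \<open>\<sigma>\<close>-algebra in the definition of \<^const>\<open>tensor_sets\<close> exists.\<close>

lemma tensor_sets_eq:
  "tensor_sets X Y = {A. A \<subseteq> space X \<times> space Y \<and>
     (\<forall>x\<in>space X. Pair x -` A \<inter> space Y \<in> sets Y) \<and>
     (\<forall>y\<in>space Y. (\<lambda>x. (x, y)) -` A \<inter> space X \<in> sets X)}" (is "_ = ?T")
  and sigma_algebra_tensor_sets: "sigma_algebra (space X \<times> space Y) (tensor_sets X Y)"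
proof -
  have sa: "sigma_algebra (space X \<times> space Y) ?T"
    unfolding sigma_algebra_iff2
  proof (intro conjI ballI allI impI)
    show "?T \<subseteq> Pow (space X \<times> space Y)" by auto
    show "{} \<in> ?T" by auto
  next
    fix A assume A: "A \<in> ?T"
    have "Pair x -` (space X \<times> space Y - A) \<inter> space Y = space Y - (Pair x -` A \<inter> space Y)"
      if "x \<in> space X" for x using that by auto
    moreover have "(\<lambda>x. (x, y)) -` (space X \<times> space Y - A) \<inter> space X
        = space X - ((\<lambda>x. (x, y)) -` A \<inter> space X)"
      if "y \<in> space Y" for y using that by auto
    ultimately show "space X \<times> space Y - A \<in> ?T" using A by auto
  next
    fix A :: "nat \<Rightarrow> ('a \<times> 'b) set" assume A: "range A \<subseteq> ?T"
    have "Pair x -` (\<Union>i. A i) \<inter> space Y = (\<Union>i. Pair x -` A i \<inter> space Y)" for x by auto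
    moreover have "(\<lambda>x. (x, y)) -` (\<Union>i. A i) \<inter> space X
        = (\<Union>i. (\<lambda>x. (x, y)) -` A i \<inter> space X)" for y by auto
    moreover have "(\<Union>i. Pair x -` A i \<inter> space Y) \<in> sets Y" if "x \<in> space X" for x
      using A that by (intro sets.countable_UN) auto
    moreover have "(\<Union>i. (\<lambda>x. (x, y)) -` A i \<inter> space X) \<in> sets X" if "y \<in> space Y" for y
      using A that by (intro sets.countable_UN) auto
    moreover have "(\<Union>i. A i) \<subseteq> space X \<times> space Y" using A by blast
    ultimately show "(\<Union>i. A i) \<in> ?T" by simp
  qed
  have "tensor_sets X Y = ?T"
    unfolding tensor_sets_def
  proof (rule Greatest_equality)
    show "sigma_algebra (space X \<times> space Y) ?T \<and>
      (\<forall>x\<in>space X. Pair x \<in> Y \<rightarrow>\<^sub>M sigma (space X \<times> space Y) ?T) \<and>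
      (\<forall>y\<in>space Y. (\<lambda>x. (x, y)) \<in> X \<rightarrow>\<^sub>M sigma (space X \<times> space Y) ?T)"
      by (intro conjI ballI sa measurable_measure_of) auto
  next
    fix S assume S: "sigma_algebra (space X \<times> space Y) S \<and>
      (\<forall>x\<in>space X. Pair x \<in> Y \<rightarrow>\<^sub>M sigma (space X \<times> space Y) S) \<and>
      (\<forall>y\<in>space Y. (\<lambda>x. (x, y)) \<in> X \<rightarrow>\<^sub>M sigma (space X \<times> space Y) S)"
    then interpret S: sigma_algebra "space X \<times> space Y" S by blast
    have eq: "sets (sigma (space X \<times> space Y) S) = S"
      by (rule S.sets_measure_of_eq)
    show "S \<subseteq> ?T"
    proof
      fix A assume A: "A \<in> S"
      have "Pair x -` A \<inter> space Y \<in> sets Y" if "x \<in> space X" for x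
        by (rule measurable_sets) (use S that A eq in blast)+
      moreover have "(\<lambda>x. (x, y)) -` A \<inter> space X \<in> sets X" if "y \<in> space Y" for y
        by (rule measurable_sets) (use S that A eq in blast)+
      ultimately show "A \<in> ?T" using S.sets_into_space[OF A] by simp
    qed
  qed
  then show "tensor_sets X Y = ?T" "sigma_algebra (space X \<times> space Y) (tensor_sets X Y)"
    using sa by simp_all
qed

lemma space_tensor_space [simp]: "space (tensor_space X Y) = space X \<times> space Y"
  by (simp add: tensor_space_def tensor_sets_eq space_measure_of_conv)

lemma sets_tensor_space: "sets (tensor_space X Y) = tensor_sets X Y"
  unfolding tensor_space_def
  using sigma_algebra.sets_measure_of_eq[OF sigma_algebra_tensor_sets] .

lemma measurable_tensor_space:
  assumes "\<And>x. x \<in> space X \<Longrightarrow> (\<lambda>y. h (x, y)) \<in> Y \<rightarrow>\<^sub>M Z"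
    and "\<And>y. y \<in> space Y \<Longrightarrow> (\<lambda>x. h (x, y)) \<in> X \<rightarrow>\<^sub>M Z"
  shows "h \<in> tensor_space X Y \<rightarrow>\<^sub>M Z"
proof (rule measurableI)
  fix z assume "z \<in> space (tensor_space X Y)"
  then show "h z \<in> space Z" using assms(1) by (auto dest: measurable_space)
next
  fix A assume A: "A \<in> sets Z"
  have "Pair x -` (h -` A \<inter> space X \<times> space Y) \<inter> space Y = (\<lambda>y. h (x, y)) -` A \<inter> space Y"
    if "x \<in> space X" for x using that by auto
  moreover have "(\<lambda>x. (x, y)) -` (h -` A \<inter> space X \<times> space Y) \<inter> space X
      = (\<lambda>x. h (x, y)) -` A \<inter> space X" if "y \<in> space Y" for y using that by auto
  ultimately show "h -` A \<inter> space (tensor_space X Y) \<in> sets (tensor_space X Y)"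
    using assms A by (auto simp: sets_tensor_space tensor_sets_eq intro: measurable_sets)
qed

lemma measurable_Pair_tensor_space:
  "x \<in> space X \<Longrightarrow> Pair x \<in> Y \<rightarrow>\<^sub>M tensor_space X Y"
  "y \<in> space Y \<Longrightarrow> (\<lambda>x. (x, y)) \<in> X \<rightarrow>\<^sub>M tensor_space X Y"
  by (auto intro!: measurableI simp: sets_tensor_space tensor_sets_eq)


text \<open>The assignments on arrows are functorial.\<close>

lemma measurable_map_prod_tensor_space:
  assumes f: "f \<in> X \<rightarrow>\<^sub>M X'" and g: "g \<in> Y \<rightarrow>\<^sub>M Y'"
  shows "map_prod f g \<in> tensor_space X Y \<rightarrow>\<^sub>M tensor_space X' Y'"
proof (rule measurable_tensor_space)
  fix x assume "x \<in> space X"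
  then have "Pair (f x) \<in> Y' \<rightarrow>\<^sub>M tensor_space X' Y'"
    using f by (intro measurable_Pair_tensor_space) (rule measurable_space)
  from measurable_compose[OF g this] show "(\<lambda>y. map_prod f g (x, y)) \<in> Y \<rightarrow>\<^sub>M tensor_space X' Y'"
    by simp
next
  fix y assume "y \<in> space Y"
  then have "(\<lambda>x. (x, g y)) \<in> X' \<rightarrow>\<^sub>M tensor_space X' Y'"
    using g by (intro measurable_Pair_tensor_space) (rule measurable_space)
  from measurable_compose[OF f this] show "(\<lambda>x. map_prod f g (x, y)) \<in> X \<rightarrow>\<^sub>M tensor_space X' Y'"
    by simp
qed

lemma measurable_map_prod_pair_measure:
  assumes "f \<in> X \<rightarrow>\<^sub>M X'" and "g \<in> Y \<rightarrow>\<^sub>M Y'"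
  shows "map_prod f g \<in> X \<Otimes>\<^sub>M Y \<rightarrow>\<^sub>M X' \<Otimes>\<^sub>M Y'"
  using assms unfolding map_prod_def by measurable

lemma measurable_giry_map:
  assumes "g \<in> Y \<rightarrow>\<^sub>M Y'"
  shows "giry_map Y' g \<in> prob_algebra Y \<rightarrow>\<^sub>M prob_algebra Y'"
  unfolding giry_map_def using assms by (rule measurable_distr_prob_space)

lemma giry_map_id:
  "Q \<in> space (prob_algebra Y) \<Longrightarrow> giry_map Y id Q = Q"
  by (simp add: giry_map_def space_prob_algebra id_def distr_id2)

lemma giry_map_comp:
  assumes "g \<in> Y \<rightarrow>\<^sub>M Y'" "h \<in> Y' \<rightarrow>\<^sub>M Y''" "Q \<in> space (prob_algebra Y)"
  shows "giry_map Y'' (h \<circ> g) Q = giry_map Y'' h (giry_map Y' g Q)"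
  using assms by (simp add: giry_map_def space_prob_algebra distr_distr cong: measurable_cong_sets)

lemma first_functor:
  shows "f \<in> X \<rightarrow>\<^sub>M X' \<Longrightarrow> g \<in> Y \<rightarrow>\<^sub>M Y' \<Longrightarrow>
      map_prod f (giry_map Y' g) \<in> tensor_space X (prob_algebra Y) \<rightarrow>\<^sub>M tensor_space X' (prob_algebra Y')"
    and "z \<in> space (tensor_space X (prob_algebra Y)) \<Longrightarrow> map_prod id (giry_map Y id) z = z"
    and "f \<in> X \<rightarrow>\<^sub>M X' \<Longrightarrow> f' \<in> X' \<rightarrow>\<^sub>M X'' \<Longrightarrow> g \<in> Y \<rightarrow>\<^sub>M Y' \<Longrightarrow> g' \<in> Y' \<rightarrow>\<^sub>M Y'' \<Longrightarrow>
      z \<in> space (tensor_space X (prob_algebra Y)) \<Longrightarrow>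
      map_prod (f' \<circ> f) (giry_map Y'' (g' \<circ> g)) z
      = map_prod f' (giry_map Y'' g') (map_prod f (giry_map Y' g) z)"
  by (auto simp: giry_map_id giry_map_comp intro: measurable_map_prod_tensor_space measurable_giry_map)

lemma second_functor:
  shows "f \<in> X \<rightarrow>\<^sub>M X' \<Longrightarrow> g \<in> Y \<rightarrow>\<^sub>M Y' \<Longrightarrow>
      giry_map (X' \<Otimes>\<^sub>M Y') (map_prod f g) \<in> prob_algebra (X \<Otimes>\<^sub>M Y) \<rightarrow>\<^sub>M prob_algebra (X' \<Otimes>\<^sub>M Y')"
    and "P \<in> space (prob_algebra (X \<Otimes>\<^sub>M Y)) \<Longrightarrow> giry_map (X \<Otimes>\<^sub>M Y) (map_prod id id) P = P"
    and "f \<in> X \<rightarrow>\<^sub>M X' \<Longrightarrow> f' \<in> X' \<rightarrow>\<^sub>M X'' \<Longrightarrow> g \<in> Y \<rightarrow>\<^sub>M Y' \<Longrightarrow> g' \<in> Y' \<rightarrow>\<^sub>M Y'' \<Longrightarrow>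
      P \<in> space (prob_algebra (X \<Otimes>\<^sub>M Y)) \<Longrightarrow>
      giry_map (X'' \<Otimes>\<^sub>M Y'') (map_prod (f' \<circ> f) (g' \<circ> g)) P
      = giry_map (X'' \<Otimes>\<^sub>M Y'') (map_prod f' g') (giry_map (X' \<Otimes>\<^sub>M Y') (map_prod f g) P)"
  by (auto simp: giry_map_id prod.map_id0 map_prod_compose
      intro!: measurable_giry_map measurable_map_prod_pair_measure giry_map_comp)

end

theory Submission
  imports Defs
begin

text \<open>
  The tensor \<open>\<sigma>\<close>-algebra is final with respect to the constant graph maps, so measurability of
  \<open>(x, Q) \<mapsto> Q\<Gamma>\<^sub>x\<^sup>-\<^sup>1\<close> on it means measurability in each variable separately
  (\<open>measurable_tensor_space\<close>).  For fixed \<open>x\<close> the map is the Giry functor applied to the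
  measurable map \<open>\<Gamma>\<^sub>x\<close>.  For fixed \<open>Q\<close>, evaluation at a measurable set \<open>\<zeta>\<close> gives \<open>x \<mapsto> Q(\<zeta>\<^sub>x)\<close>, the
  measure of a section, which is measurable in \<open>x\<close> by the first step of Fubini's theorem (here
  inside \<open>measurable_distr_prob_space2\<close>).  That step concerns sets in the product \<open>\<sigma>\<close>-algebra,
  which is the one the target \<open>X \<times> Y\<close> carries.

  For naturality, \<open>\<tau>''(x, Q)\<close> is \<open>\<G>(\<Gamma>\<^sub>x)(Q)\<close>, so it suffices to apply the functor \<open>\<G>\<close> to the
  identity \<open>\<Gamma>\<^bsub>f x\<^esub> \<circ> g = (f \<times> g) \<circ> \<Gamma>\<^sub>x\<close> of maps \<open>Y \<rightarrow> X' \<times> Y'\<close>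
  (\<open>tau_natural\<close>).
\<close>

lemma measurable_tau:
  "tau X Y \<in> tensor_space X (prob_algebra Y) \<rightarrow>\<^sub>M prob_algebra (X \<Otimes>\<^sub>M Y)"
proof (rule measurable_tensor_space)
  fix x assume "x \<in> space X"
  then have "Pair x \<in> Y \<rightarrow>\<^sub>M X \<Otimes>\<^sub>M Y"
    by simp
  then show "(\<lambda>Q. tau X Y (x, Q)) \<in> prob_algebra Y \<rightarrow>\<^sub>M prob_algebra (X \<Otimes>\<^sub>M Y)"
    by (simp add: tau_def measurable_distr_prob_space)
next
  fix Q assume "Q \<in> space (prob_algebra Y)"
  then have "(\<lambda>x. Q) \<in> X \<rightarrow>\<^sub>M prob_algebra Y"
    by simp
  \<comment> \<open>The graph map \<open>\<Gamma>\<^sub>x\<close>, read as a map of the pair \<open>(x, y)\<close>, is the identity; so the family of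
    all \<open>\<Gamma>\<^sub>x\<close> is jointly measurable, which is what a parametrised push-forward requires.\<close>
  moreover have "(\<lambda>(x, y). (x, y)) \<in> X \<Otimes>\<^sub>M Y \<rightarrow>\<^sub>M X \<Otimes>\<^sub>M Y"
    by simp
  ultimately have "(\<lambda>x. distr Q (X \<Otimes>\<^sub>M Y) (Pair x)) \<in> X \<rightarrow>\<^sub>M prob_algebra (X \<Otimes>\<^sub>M Y)"
    by (rule measurable_distr_prob_space2)
  then show "(\<lambda>x. tau X Y (x, Q)) \<in> X \<rightarrow>\<^sub>M prob_algebra (X \<Otimes>\<^sub>M Y)"
    by (simp add: tau_def)
qed

lemma tau_natural:
  assumes f: "f \<in> X \<rightarrow>\<^sub>M X'" and g: "g \<in> Y \<rightarrow>\<^sub>M Y'"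
    and x: "x \<in> space X" and Q: "Q \<in> space (prob_algebra Y)"
  shows "tau X' Y' (f x, giry_map Y' g Q)
    = giry_map (X' \<Otimes>\<^sub>M Y') (map_prod f g) (tau X Y (x, Q))"
proof -
  have fx: "Pair (f x) \<in> Y' \<rightarrow>\<^sub>M X' \<Otimes>\<^sub>M Y'" and px: "Pair x \<in> Y \<rightarrow>\<^sub>M X \<Otimes>\<^sub>M Y"
    using measurable_space[OF f x] x by simp_all
  have "tau X' Y' (f x, giry_map Y' g Q)
      = giry_map (X' \<Otimes>\<^sub>M Y') (Pair (f x)) (giry_map Y' g Q)"
    by (simp add: tau_def giry_map_def)
  also have "\<dots> = giry_map (X' \<Otimes>\<^sub>M Y') (Pair (f x) \<circ> g) Q"
    by (rule giry_map_comp[OF g fx Q, symmetric])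
  also have "Pair (f x) \<circ> g = map_prod f g \<circ> Pair x"
    by auto
  also have "giry_map (X' \<Otimes>\<^sub>M Y') (map_prod f g \<circ> Pair x) Q
      = giry_map (X' \<Otimes>\<^sub>M Y') (map_prod f g) (giry_map (X \<Otimes>\<^sub>M Y) (Pair x) Q)"
    by (rule giry_map_comp[OF px measurable_map_prod_pair_measure[OF f g] Q])
  also have "giry_map (X \<Otimes>\<^sub>M Y) (Pair x) Q = tau X Y (x, Q)"
    by (simp add: tau_def giry_map_def)
  finally show ?thesis .
qed

theorem theorem3p1:
  fixes X :: "'a measure" and X' :: "'b measure" and Y :: "'c measure" and Y' :: "'d measure"
  shows "tau X Y \<in> tensor_space X (prob_algebra Y) \<rightarrow>\<^sub>M prob_algebra (X \<Otimes>\<^sub>M Y) \<and>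
    (\<forall>f\<in>X \<rightarrow>\<^sub>M X'. \<forall>g\<in>Y \<rightarrow>\<^sub>M Y'. \<forall>z\<in>space (tensor_space X (prob_algebra Y)).
       tau X' Y' (map_prod f (giry_map Y' g) z)
       = giry_map (X' \<Otimes>\<^sub>M Y') (map_prod f g) (tau X Y z))"
  by (auto simp: measurable_tau tau_natural)

end
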